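(* Suppose $N_{\rm sc}$ is even, and the transmitted symbols are i.i.d. BPSK symbols or i.i.d. $\pi/2$-BPSK symbols (i.e., built from i.i.d. equiprobable bits). Then, for every $m\in\{0,\dots,N_{\rm sc}-1\}$, the effective SINR of the real received symbol $r_{\rm R}[m]=\mu_G\sqrt2\,\alpha_m+\mathsf{ICI}_{\rm R}[m]+n_{\rm R}[m]$, namely $\mathsf{SINR}^{\rm BPSK}=\mu_G^2/\left(\mathbb{E}[\mathsf{ICI}_{\rm R}[m]^2]+\mathbb{E}[n_{\rm R}[m]^2]\right)$, equals $$\mathsf{SINR}^{\rm BPSK}=\frac{\mu_G^2}{\zeta_G^2+\frac12\mu_{|E|^2}},$$ where $\mu_{|E|^2}=\frac{1}{N_{\rm sc}}\sum_{k=0}^{N_{\rm sc}-1}|E_k|^2$ and the interference power $\zeta_G^2=\mathbb{E}[\mathsf{ICI}_{\rm R}[m]^2]$ is $$\zeta_G^2=\begin{cases}\displaystyle\frac{1}{2N_{\rm sc}}\sum_{k=0}^{N_{\rm sc}-1}G_k\left(G_{N_{\rm sc}-k}+G_k\right)-\mu_G^2&\text{for BPSK},\\[3mm]\displaystyle\frac{1}{2N_{\rm sc}}\sum_{k=0}^{N_{\rm sc}-1}G_k\left(G_{\frac{N_{\rm sc}}{2}-k}+G_k\right)-\mu_G^2&\text{for }\pi/2\text{-BPSK},\end{cases}$$ with the indices of $G$ taken modulo $N_{\rm sc}$.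
   Context: Let ${\rm j}=\sqrt{-1}$. Bits $b_0,\dots,b_{N_{\rm sc}-1}\in\{0,1\}$ are i.i.d. equiprobable and $\alpha_m=\frac{1}{\sqrt2}(1-2b_m)$. The transmitted symbols are $x[m]=\alpha_m(1+{\rm j})=\sqrt2\,\alpha_me^{{\rm j}\pi/4}$ for BPSK, and $x[m]=e^{{\rm j}\frac{\pi}{2}(m\bmod 2)}\sqrt2\,\alpha_me^{{\rm j}\pi/4}$ for $\pi/2$-BPSK. The DFT-precoded coefficients are $X_k=\frac{1}{\sqrt{N_{\rm sc}}}\sum_{m=0}^{N_{\rm sc}-1}x[m]e^{-{\rm j}\frac{2\pi}{N_{\rm sc}}km}$, $0\le k\le N_{\rm sc}-1$. After OFDM demodulation, $Y_k=\widetilde H_kX_k+Z_k$, where $\widetilde H_k\in\mathbb{C}$ are fixed (deterministic) effective channel coefficients, and $Z_0,\dots,Z_{N_{\rm sc}-1}$ are i.i.d. circularly symmetric complex Gaussian with zero mean and $\mathbb{E}[|Z_k|^2]=1$, independent of the data. A single-tap equalizer with deterministic coefficients $E_k\in\mathbb{C}$ is applied, $\widetilde Y_k=E_kY_k$, such that $G_k=E_k\widetilde H_k$ is real for every $k$; the index of $G$ is extended modulo $N_{\rm sc}$. After DFT de-spreading, $r[m]=\frac{1}{\sqrt{N_{\rm sc}}}\sum_{k=0}^{N_{\rm sc}-1}\widetilde Y_ke^{{\rm j}\frac{2\pi}{N_{\rm sc}}km}$, with noise component $n[m]=\frac{1}{\sqrt{N_{\rm sc}}}\sum_{k=0}^{N_{\rm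 sc}-1}E_kZ_ke^{{\rm j}\frac{2\pi}{N_{\rm sc}}km}$. Put $\mu_G=\frac{1}{N_{\rm sc}}\sum_{k=0}^{N_{\rm sc}-1}G_k$. The receiver de-rotates and takes the real part: for BPSK, $r_{\rm R}[m]=\Re\{e^{-{\rm j}\frac{\pi}{4}}r[m]\}$ and $n_{\rm R}[m]=\Re\{e^{-{\rm j}\frac{\pi}{4}}n[m]\}$; for $\pi/2$-BPSK, $r_{\rm R}[m]=\Re\{e^{-{\rm j}\frac{\pi}{2}(\frac12+(m\bmod 2))}r[m]\}$ and $n_{\rm R}[m]=\Re\{e^{-{\rm j}\frac{\pi}{2}(\frac12+(m\bmod 2))}n[m]\}$. The interference term is $\mathsf{ICI}_{\rm R}[m]=\sum_{n=0,\,n\ne m}^{N_{\rm sc}-1}\sqrt2\,\alpha_n\,g^{\rm R}_{m,n}$ where, with $g_a=\frac{1}{N_{\rm sc}}\sum_{k=0}^{N_{\rm sc}-1}G_ke^{{\rm j}\frac{2\pi}{N_{\rm sc}}ka}$, one has $g^{\rm R}_{m,n}=\Re\{g_{m-n}\}$ for BPSK and $g^{\rm R}_{m,n}=\Re\{e^{{\rm j}\frac{\pi}{2}((n\bmod 2)-(m\bmod 2))}g_{m-n}\}$ for $\pi/2$-BPSK, so that $r_{\rm R}[m]=\mu_G\sqrt2\,\alpha_m+\mathsf{ICI}_{\rm R}[m]+n_{\rm R}[m]$. Expectations are over data and noise. *)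

theory Defs
  imports "HOL-Probability.Probability"
begin

section \<open>Random variables\<close>

definition iid_vars ::
  "'w measure \<Rightarrow> 'v measure \<Rightarrow> ('i \<Rightarrow> 'w \<Rightarrow> 'v) \<Rightarrow> 'i set \<Rightarrow> bool" where
  "iid_vars M S X I \<longleftrightarrow>
     prob_space.indep_vars M (\<lambda>_. S) X I \<and>
     (\<forall>i\<in>I. \<forall>j\<in>I. distr M S (X i) = distr M S (X j))"

text \<open>\<open>indep_var\<close> requires both variables to have the same type, hence the following variant.\<close>

definition indep_rvs ::
  "'w measure \<Rightarrow> 'u measure \<Rightarrow> ('w \<Rightarrow> 'u) \<Rightarrow> 'v measure \<Rightarrow> ('w \<Rightarrow> 'v) \<Rightarrow> bool" where
  "indep_rvs M S X T Y \<longleftrightarrow>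
     X \<in> measurable M S \<and> Y \<in> measurable M T \<and>
     prob_space.indep_set M
       {X -` A \<inter> space M | A. A \<in> sets S} {Y -` B \<inter> space M | B. B \<in> sets T}"

text \<open>Almost surely constant variables count as (degenerate) Gaussian variables, as is needed for
  the characterisation of joint normality by linear combinations below.\<close>

definition real_gaussian :: "'w measure \<Rightarrow> ('w \<Rightarrow> real) \<Rightarrow> bool" where
  "real_gaussian M X \<longleftrightarrow>
     (\<exists>\<mu> \<sigma>. \<sigma> > 0 \<and> distributed M lborel X (\<lambda>x. ennreal (normal_density \<mu> \<sigma> x))) \<or>
     (\<exists>c. AE \<omega> in M. X \<omega> = c)"

text \<open>Real and imaginary part are jointly Gaussian: all their real linear combinations are
  Gaussian.\<close>

definition complex_gaussian :: "'w measure \<Rightarrow> ('w \<Rightarrow> complex) \<Rightarrow> bool" where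
  "complex_gaussian M Z \<longleftrightarrow>
     Z \<in> borel_measurable M \<and>
     (\<forall>s t. real_gaussian M (\<lambda>\<omega>. s * Re (Z \<omega>) + t * Im (Z \<omega>)))"

definition circularly_symmetric :: "'w measure \<Rightarrow> ('w \<Rightarrow> complex) \<Rightarrow> bool" where
  "circularly_symmetric M Z \<longleftrightarrow>
     (\<forall>\<theta>. distr M borel (\<lambda>\<omega>. cis \<theta> * Z \<omega>) = distr M borel Z)"


section \<open>The DFT-precoded transmission chain\<close>

text \<open>The functions of this section act on a single realisation. Throughout, \<open>N\<close> is the number of
  subcarriers, and sequences of length \<open>N\<close> are functions on \<open>nat\<close> of which only the values below
  \<open>N\<close> are used.\<close>

datatype modulation = BPSK | Half_Pi_BPSK

definition bit_amplitude :: "nat \<Rightarrow> real" where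
  "bit_amplitude c = 1 / sqrt 2 * (1 - 2 * real c)"

fun tx_symbol :: "modulation \<Rightarrow> (nat \<Rightarrow> nat) \<Rightarrow> nat \<Rightarrow> complex" where
  "tx_symbol BPSK b m = of_real (bit_amplitude (b m)) * (1 + \<i>)"
| "tx_symbol Half_Pi_BPSK b m =
     cis (pi / 2 * real (m mod 2)) * of_real (sqrt 2 * bit_amplitude (b m)) * cis (pi / 4)"

definition dft :: "nat \<Rightarrow> (nat \<Rightarrow> complex) \<Rightarrow> nat \<Rightarrow> complex" where
  "dft N x k =
     of_real (1 / sqrt (real N)) * (\<Sum>m<N. x m * cis (- (2 * pi / real N * real k * real m)))"

definition idft :: "nat \<Rightarrow> (nat \<Rightarrow> complex) \<Rightarrow> nat \<Rightarrow> complex" where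
  "idft N X m =
     of_real (1 / sqrt (real N)) * (\<Sum>k<N. X k * cis (2 * pi / real N * real k * real m))"

text \<open>Equalizer \<open>E\<close>, channel \<open>H\<close>, bits \<open>b\<close>, frequency-domain noise \<open>Z\<close>.\<close>

definition received :: "modulation \<Rightarrow> nat \<Rightarrow> (nat \<Rightarrow> complex) \<Rightarrow> (nat \<Rightarrow> complex) \<Rightarrow>
    (nat \<Rightarrow> nat) \<Rightarrow> (nat \<Rightarrow> complex) \<Rightarrow> nat \<Rightarrow> complex" where
  "received md N E H b Z = idft N (\<lambda>k. E k * (H k * dft N (tx_symbol md b) k + Z k))"

definition noise :: "nat \<Rightarrow> (nat \<Rightarrow> complex) \<Rightarrow> (nat \<Rightarrow> complex) \<Rightarrow> nat \<Rightarrow> complex" where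
  "noise N E Z = idft N (\<lambda>k. E k * Z k)"

fun derotate :: "modulation \<Rightarrow> nat \<Rightarrow> complex \<Rightarrow> real" where
  "derotate BPSK m z = Re (cis (- (pi / 4)) * z)"
| "derotate Half_Pi_BPSK m z = Re (cis (- (pi / 2 * (1 / 2 + real (m mod 2)))) * z)"

definition received_real :: "modulation \<Rightarrow> nat \<Rightarrow> (nat \<Rightarrow> complex) \<Rightarrow> (nat \<Rightarrow> complex) \<Rightarrow>
    (nat \<Rightarrow> nat) \<Rightarrow> (nat \<Rightarrow> complex) \<Rightarrow> nat \<Rightarrow> real" where
  "received_real md N E H b Z m = derotate md m (received md N E H b Z m)"

definition noise_real ::
  "modulation \<Rightarrow> nat \<Rightarrow> (nat \<Rightarrow> complex) \<Rightarrow> (nat \<Rightarrow> complex) \<Rightarrow> nat \<Rightarrow> real" where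
  "noise_real md N E Z m = derotate md m (noise N E Z m)"

definition mean :: "nat \<Rightarrow> (nat \<Rightarrow> real) \<Rightarrow> real" where
  "mean N f = 1 / real N * (\<Sum>k<N. f k)"

definition impulse :: "nat \<Rightarrow> (nat \<Rightarrow> real) \<Rightarrow> int \<Rightarrow> complex" where
  "impulse N G a =
     of_real (1 / real N) * (\<Sum>k<N. of_real (G k) * cis (2 * pi / real N * real k * real_of_int a))"

fun impulse_real :: "modulation \<Rightarrow> nat \<Rightarrow> (nat \<Rightarrow> real) \<Rightarrow> nat \<Rightarrow> nat \<Rightarrow> real" where
  "impulse_real BPSK N G m n = Re (impulse N G (int m - int n))"
| "impulse_real Half_Pi_BPSK N G m n =
     Re (cis (pi / 2 * (real (n mod 2) - real (m mod 2))) * impulse N G (int m - int n))"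

definition ici_real ::
  "modulation \<Rightarrow> nat \<Rightarrow> (nat \<Rightarrow> real) \<Rightarrow> (nat \<Rightarrow> nat) \<Rightarrow> nat \<Rightarrow> real" where
  "ici_real md N G b m =
     (\<Sum>n\<in>{..<N} - {m}. sqrt 2 * bit_amplitude (b n) * impulse_real md N G m n)"


section \<open>SINR and interference power\<close>

definition effective_sinr :: "'w measure \<Rightarrow> modulation \<Rightarrow> nat \<Rightarrow> (nat \<Rightarrow> complex) \<Rightarrow> (nat \<Rightarrow> real) \<Rightarrow>
    (nat \<Rightarrow> 'w \<Rightarrow> nat) \<Rightarrow> (nat \<Rightarrow> 'w \<Rightarrow> complex) \<Rightarrow> nat \<Rightarrow> real" where
  "effective_sinr M md N E G b Z m =
     (mean N G)\<^sup>2 /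
       ((\<integral>\<omega>. (ici_real md N G (\<lambda>i. b i \<omega>) m)\<^sup>2 \<partial>M) +
        (\<integral>\<omega>. (noise_real md N E (\<lambda>k. Z k \<omega>) m)\<^sup>2 \<partial>M))"

definition periodic :: "nat \<Rightarrow> (nat \<Rightarrow> real) \<Rightarrow> int \<Rightarrow> real" where
  "periodic N G i = G (nat (i mod int N))"

fun ici_power :: "modulation \<Rightarrow> nat \<Rightarrow> (nat \<Rightarrow> real) \<Rightarrow> real" where
  "ici_power BPSK N G =
     1 / (2 * real N) * (\<Sum>k<N. G k * (periodic N G (int N - int k) + G k)) - (mean N G)\<^sup>2"
| "ici_power Half_Pi_BPSK N G =
     1 / (2 * real N) * (\<Sum>k<N. G k * (periodic N G (int (N div 2) - int k) + G k)) - (mean N G)\<^sup>2"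

end

(* The cross terms of both second moments vanish by independence and zero means, so the
   interference power is the sum over n \<noteq> m of the squared real impulse responses, each a sum of
   terms G k * cos A_k. Expanding the square, cos A_k * cos A_l = (cos (A_k - A_l) + cos (A_k + A_l)) / 2,
   and orthogonality over n keeps the pairs with k = l and those with k + l = 0 (BPSK) or
   k + l = N / 2 (pi/2-BPSK) modulo N; the omitted term n = m is the squared mean.
   For the noise, circular symmetry lets each coefficient be replaced by its modulus and gives Re Z
   and Im Z (a rotation of Z by pi/2) the same second moment 1/2. *)

theory Submission
  imports Defs "HOL-Library.Real_Mod"
begin

section \<open>Second moments: independent sums and circularly symmetric variables\<close>

text \<open>The mixed moments factor by independence and each factor has mean zero, so only the
  diagonal of the expanded square survives. Square integrability yields first moments because the
  measure is finite.\<close>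

lemma (in prob_space) second_moment_sum_indep:
  fixes X :: "'i \<Rightarrow> 'a \<Rightarrow> real"
  assumes "finite I" and indep: "indep_vars (\<lambda>_. borel) X I"
    and sq: "\<And>i. i \<in> I \<Longrightarrow> integrable M (\<lambda>\<omega>. (X i \<omega>)\<^sup>2)"
    and zero: "\<And>i. i \<in> I \<Longrightarrow> expectation (X i) = 0"
  shows "integrable M (\<lambda>\<omega>. (\<Sum>i\<in>I. X i \<omega>)\<^sup>2)"
    and "expectation (\<lambda>\<omega>. (\<Sum>i\<in>I. X i \<omega>)\<^sup>2) = (\<Sum>i\<in>I. expectation (\<lambda>\<omega>. (X i \<omega>)\<^sup>2))"
proof -
  have rv: "random_variable borel (X i)" if "i \<in> I" for i
    using indep that by (auto simp: indep_vars_def)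
  have int: "integrable M (X i)" if "i \<in> I" for i
    using square_integrable_imp_integrable[OF rv sq] that by blast
  have cross: "integrable M (\<lambda>\<omega>. X i \<omega> * X j \<omega>) \<and>
      expectation (\<lambda>\<omega>. X i \<omega> * X j \<omega>) = (if i = j then expectation (\<lambda>\<omega>. (X i \<omega>)\<^sup>2) else 0)"
    if "i \<in> I" "j \<in> I" for i j
  proof (cases "i = j")
    case True
    then show ?thesis using sq that by (simp add: power2_eq_square)
  next
    case False
    \<comment> \<open>Restricting the family to two distinct indices turns the product over the
      index set into \<open>X i * X j\<close>.\<close>
    have ij: "indep_vars (\<lambda>_. borel) X {i, j}"
      by (rule indep_vars_subset[OF indep]) (use that in auto)
    have "\<And>k. k \<in> {i, j} \<Longrightarrow> integrable M (X k)" using int that by auto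
    from indep_vars_integrable[OF _ ij this] indep_vars_lebesgue_integral[OF _ ij this]
    show ?thesis using False zero that by simp
  qed
  have square: "(\<Sum>i\<in>I. X i \<omega>)\<^sup>2 = (\<Sum>i\<in>I. \<Sum>j\<in>I. X i \<omega> * X j \<omega>)" for \<omega>
    by (simp add: power2_eq_square sum_product)
  show "integrable M (\<lambda>\<omega>. (\<Sum>i\<in>I. X i \<omega>)\<^sup>2)"
    unfolding square using cross by (intro Bochner_Integration.integrable_sum) blast
  have "expectation (\<lambda>\<omega>. (\<Sum>i\<in>I. X i \<omega>)\<^sup>2) = (\<Sum>i\<in>I. \<Sum>j\<in>I. expectation (\<lambda>\<omega>. X i \<omega> * X j \<omega>))"
    unfolding square using cross
    by (subst Bochner_Integration.integral_sum)
      (auto intro!: Bochner_Integration.integrable_sum sum.cong Bochner_Integration.integral_sum)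
  also have "\<dots> = (\<Sum>i\<in>I. \<Sum>j\<in>I. if i = j then expectation (\<lambda>\<omega>. (X i \<omega>)\<^sup>2) else 0)"
    using cross by (intro sum.cong refl) blast
  also have "\<dots> = (\<Sum>i\<in>I. expectation (\<lambda>\<omega>. (X i \<omega>)\<^sup>2))"
    using \<open>finite I\<close> by simp
  finally show "expectation (\<lambda>\<omega>. (\<Sum>i\<in>I. X i \<omega>)\<^sup>2) = (\<Sum>i\<in>I. expectation (\<lambda>\<omega>. (X i \<omega>)\<^sup>2))" .
qed

lemma Re_of_real_mult: "Re (of_real a * z) = a * Re z"
  by simp

text \<open>Only the modulus of \<open>w\<close> matters: its phase rotates \<open>Z\<close>, which
  leaves the law unchanged. Real and imaginary part have equal second moments, so each carries half
  of the power.\<close>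

lemma (in prob_space) circularly_symmetric_Re_square:
  fixes Z :: "'a \<Rightarrow> complex"
  assumes [measurable]: "random_variable borel Z"
    and circ: "circularly_symmetric M Z"
    and int: "integrable M (\<lambda>\<omega>. (cmod (Z \<omega>))\<^sup>2)"
  shows "integrable M (\<lambda>\<omega>. (Re (w * Z \<omega>))\<^sup>2)"
    and "expectation (\<lambda>\<omega>. (Re (w * Z \<omega>))\<^sup>2) = (cmod w)\<^sup>2 / 2 * expectation (\<lambda>\<omega>. (cmod (Z \<omega>))\<^sup>2)"
proof -
  have Re_int: "integrable M (\<lambda>\<omega>. (Re (v * Z \<omega>))\<^sup>2)" for v
  proof (rule Bochner_Integration.integrable_bound)
    show "integrable M (\<lambda>\<omega>. (cmod v)\<^sup>2 * (cmod (Z \<omega>))\<^sup>2)"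
      using int by simp
    have "\<bar>Re (v * z)\<bar>\<^sup>2 \<le> (cmod v)\<^sup>2 * (cmod z)\<^sup>2" for z
      using power_mono[OF abs_Re_le_cmod[of "v * z"], of 2]
      by (simp only: norm_mult power_mult_distrib abs_ge_zero)
    then show "AE \<omega> in M. norm ((Re (v * Z \<omega>))\<^sup>2) \<le> norm ((cmod v)\<^sup>2 * (cmod (Z \<omega>))\<^sup>2)"
      by simp
  qed simp
  then show "integrable M (\<lambda>\<omega>. (Re (w * Z \<omega>))\<^sup>2)" .
  have rotate: "expectation (\<lambda>\<omega>. (Re (cis \<theta> * Z \<omega>))\<^sup>2) = expectation (\<lambda>\<omega>. (Re (Z \<omega>))\<^sup>2)" for \<theta>
  proof -
    have "expectation (\<lambda>\<omega>. (Re (cis \<theta> * Z \<omega>))\<^sup>2) = (\<integral>z. (Re z)\<^sup>2 \<partial>distr M borel (\<lambda>\<omega>. cis \<theta> * Z \<omega>))"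
      by (subst integral_distr) auto
    also have "\<dots> = (\<integral>z. (Re z)\<^sup>2 \<partial>distr M borel Z)"
      using circ by (simp add: circularly_symmetric_def)
    also have "\<dots> = expectation (\<lambda>\<omega>. (Re (Z \<omega>))\<^sup>2)"
      by (subst integral_distr) auto
    finally show ?thesis .
  qed
  \<comment> \<open>The real part after a quarter turn is minus the imaginary part, so both squares
    take the form that \<open>rotate\<close> handles.\<close>
  have "expectation (\<lambda>\<omega>. (cmod (Z \<omega>))\<^sup>2) =
      expectation (\<lambda>\<omega>. (Re (Z \<omega>))\<^sup>2 + (Re (cis (pi / 2) * Z \<omega>))\<^sup>2)"
    by (simp add: cmod_power2)
  also have "\<dots> = expectation (\<lambda>\<omega>. (Re (Z \<omega>))\<^sup>2) + expectation (\<lambda>\<omega>. (Re (cis (pi / 2) * Z \<omega>))\<^sup>2)"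
    using Re_int[of 1] Re_int[of \<i>] by (intro Bochner_Integration.integral_add) simp_all
  also have "\<dots> = 2 * expectation (\<lambda>\<omega>. (Re (Z \<omega>))\<^sup>2)"
    by (simp only: rotate)
  finally have half: "expectation (\<lambda>\<omega>. (cmod (Z \<omega>))\<^sup>2) = 2 * expectation (\<lambda>\<omega>. (Re (Z \<omega>))\<^sup>2)" .
  have polar: "Re (w * z) = cmod w * Re (cis (Arg w) * z)" for z
  proof -
    have "w * z = of_real (cmod w) * (cis (Arg w) * z)"
      using rcis_cmod_Arg[of w] by (simp add: rcis_def mult.assoc[symmetric])
    then show ?thesis by (simp only: Re_of_real_mult)
  qed
  have "expectation (\<lambda>\<omega>. (Re (w * Z \<omega>))\<^sup>2) =
      (cmod w)\<^sup>2 * expectation (\<lambda>\<omega>. (Re (cis (Arg w) * Z \<omega>))\<^sup>2)"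
    by (simp only: polar power_mult_distrib integral_mult_right_zero)
  then show "expectation (\<lambda>\<omega>. (Re (w * Z \<omega>))\<^sup>2) =
      (cmod w)\<^sup>2 / 2 * expectation (\<lambda>\<omega>. (cmod (Z \<omega>))\<^sup>2)"
    by (simp only: rotate half)
qed

section \<open>Orthogonality of sampled cosines\<close>

text \<open>Real part of a geometric sum whose ratio is an \<open>N\<close>-th root of unity: it
  vanishes unless the ratio is 1. The offset \<open>m\<close> only contributes a constant
  phase.\<close>

lemma sum_cos_orthogonal:
  fixes j :: int and m N :: nat
  assumes "0 < N"
  shows "(\<Sum>n<N. cos (2 * pi * real_of_int (j * (int m - int n)) / real N)) =
    (if int N dvd j then real N else 0)"
proof -
  define z where "z = cis (- (2 * pi * of_int j / N))"
  have cis_term: "cis (2 * pi * real_of_int (j * (int m - int n)) / real N) =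
      cis (2 * pi * of_int j * m / N) * z ^ n" for n
    unfolding z_def Complex.DeMoivre cis_mult by (simp add: algebra_simps diff_divide_distrib)
  have z_one: "z = 1 \<longleftrightarrow> int N dvd j"
  proof
    assume "z = 1"
    then obtain k where "- (2 * pi * of_int j / N) = of_int k * (2 * pi)"
      unfolding z_def cis_eq_1_iff by blast
    then have "2 * pi * of_int j = 2 * pi * (- of_int k * real N)"
      using assms by (simp add: field_simps)
    then have "real_of_int j = - of_int k * real N"
      by (simp only: mult_cancel_left) simp
    then have "real_of_int j = of_int (int N * (- k))"
      by (simp add: mult.commute)
    then show "int N dvd j" unfolding of_int_eq_iff by simp
  next
    assume "int N dvd j"
    then obtain k where "j = int N * k" ..
    then have "- (2 * pi * of_int j / N) = of_int (- k) * (2 * pi)"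
      using assms by simp
    then show "z = 1" unfolding z_def cis_eq_1_iff by blast
  qed
  have pow: "z ^ N = 1"
  proof -
    have "real N * (- (2 * pi * of_int j / N)) = of_int (- j) * (2 * pi)"
      using assms by simp
    then show ?thesis unfolding z_def Complex.DeMoivre cis_eq_1_iff by blast
  qed
  have "(\<Sum>n<N. cos (2 * pi * real_of_int (j * (int m - int n)) / real N)) =
      Re (cis (2 * pi * of_int j * m / N) * (\<Sum>n<N. z ^ n))"
    by (simp only: sum_distrib_left flip: cis_term) simp
  also have "\<dots> = (if int N dvd j then real N else 0)"
  proof (cases "int N dvd j")
    case True
    then obtain k where k: "j = int N * k" ..
    \<comment> \<open>When \<open>N\<close> divides \<open>j\<close>, the constant phase in front is
      a whole number of turns and drops out too.\<close>
    have "2 * pi * of_int j * m / N = of_int (k * int m) * (2 * pi)"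
      using assms by (simp add: k)
    then have "cis (2 * pi * of_int j * m / N) = 1"
      unfolding cis_eq_1_iff by blast
    then show ?thesis using True z_one by simp
  next
    case False
    then show ?thesis using z_one pow geometric_sum[of z N] by simp
  qed
  finally show ?thesis .
qed

section \<open>Common description of both modulations and of the received symbol\<close>

text \<open>The phase added on top of the common pi / 4; isolating it lets both modulations share
  one argument.\<close>

fun rotation :: "modulation \<Rightarrow> nat \<Rightarrow> real" where
  "rotation BPSK m = 0"
| "rotation Half_Pi_BPSK m = pi / 2 * real (m mod 2)"

text \<open>In the energy of the impulse response, index \<open>k\<close> is paired with this value
  minus \<open>k\<close>, modulo \<open>N\<close>. For \<open>BPSK\<close> the residue is 0; the
  representative \<open>N\<close> matches \<open>ici_power\<close>.\<close>

fun reflection_center :: "modulation \<Rightarrow> nat \<Rightarrow> nat" where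
  "reflection_center BPSK N = N"
| "reflection_center Half_Pi_BPSK N = N div 2"

lemma tx_symbol_eq:
  "tx_symbol md b m = of_real (sqrt 2 * bit_amplitude (b m)) * cis (pi / 4 + rotation md m)"
proof (cases md)
  case BPSK
  have "1 + \<i> = of_real (sqrt 2) * cis (pi / 4)"
    by (simp add: complex_eq_iff cos_45 sin_45)
  then show ?thesis by (simp add: BPSK)
next
  case Half_Pi_BPSK
  then show ?thesis by (simp add: cis_mult[symmetric])
qed

lemma derotate_eq: "derotate md m z = Re (cis (- (pi / 4 + rotation md m)) * z)"
  by (cases md) (simp_all add: algebra_simps)

lemma derotate_add: "derotate md m (z + w) = derotate md m z + derotate md m w"
  by (simp only: derotate_eq distrib_left plus_complex.sel)

lemma derotate_sum: "derotate md m (\<Sum>i\<in>I. f i) = (\<Sum>i\<in>I. derotate md m (f i))"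
  by (simp only: derotate_eq sum_distrib_left Re_sum)

lemma impulse_real_eq:
  "impulse_real md N G m n = Re (cis (rotation md n - rotation md m) * impulse N G (int m - int n))"
  by (cases md) (simp_all add: right_diff_distrib)

text \<open>The common phase pi / 4 cancels between transmitter and receiver, leaving the relative
  rotation that \<open>impulse_real\<close> contains.\<close>

lemma derotate_tx_symbol_mult_impulse:
  "derotate md m (tx_symbol md b n * impulse N G (int m - int n)) =
    sqrt 2 * bit_amplitude (b n) * impulse_real md N G m n"
proof -
  have "cis (- (pi / 4 + rotation md m)) * (tx_symbol md b n * impulse N G (int m - int n)) =
    of_real (sqrt 2 * bit_amplitude (b n)) *
      ((cis (- (pi / 4 + rotation md m)) * cis (pi / 4 + rotation md n)) * impulse N G (int m - int n))"
    by (simp only: tx_symbol_eq mult_ac)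
  also have "cis (- (pi / 4 + rotation md m)) * cis (pi / 4 + rotation md n) =
      cis (rotation md n - rotation md m)"
    by (simp add: cis_mult)
  finally show ?thesis
    by (simp only: derotate_eq impulse_real_eq Re_of_real_mult)
qed

text \<open>As \<open>G\<close> is real, taking the real part turns each exponential into a cosine,
  with the relative rotation as phase offset.\<close>

lemma impulse_real_cos:
  "impulse_real md N G m n =
    1 / real N * (\<Sum>k<N. G k * cos (2 * pi / real N * real k * real_of_int (int m - int n)
      + (rotation md n - rotation md m)))"
proof -
  have "Re (cis \<phi> * (of_real a * (\<Sum>k<N. of_real (G k) * cis (t k)))) =
      a * (\<Sum>k<N. G k * cos (t k + \<phi>))" for \<phi> a t
    by (simp add: cos_add sum_distrib_left sum_distrib_right sum_subtractf[symmetric] algebra_simps)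
  then show ?thesis
    by (simp only: impulse_real_eq impulse_def)
qed

lemma impulse_real_diag: "impulse_real md N G m m = mean N G"
  by (simp add: impulse_real_cos mean_def)

lemma idft_add: "idft N (\<lambda>k. X k + Y k) m = idft N X m + idft N Y m"
  by (simp add: idft_def distrib_right sum.distrib distrib_left)

text \<open>A gain applied between DFT and inverse DFT is a circular convolution in time: once the
  sums are exchanged, the sum over \<open>k\<close> is the impulse response, and the two factors 1 /
  sqrt N merge into its 1 / N.\<close>

lemma idft_real_gain_dft:
  assumes "0 < N"
  shows "idft N (\<lambda>k. of_real (G k) * dft N x k) m = (\<Sum>n<N. x n * impulse N G (int m - int n))"
proof -
  have scale: "of_real (1 / sqrt (real N)) * of_real (1 / sqrt (real N)) =
      (of_real (1 / real N) :: complex)"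
    using assms by (simp flip: of_real_mult)
  have "idft N (\<lambda>k. of_real (G k) * dft N x k) m =
     (\<Sum>k<N. \<Sum>n<N. (of_real (1 / sqrt (real N)) * of_real (1 / sqrt (real N))) *
        (x n * of_real (G k) *
        (cis (2 * pi / real N * real k * real m) * cis (- (2 * pi / real N * real k * real n)))))"
    by (simp only: idft_def dft_def sum_distrib_left sum_distrib_right mult_ac)
  also have "\<dots> = (\<Sum>k<N. \<Sum>n<N. of_real (1 / real N) *
        (x n * of_real (G k) * cis (2 * pi / real N * real k * real_of_int (int m - int n))))"
    by (simp only: scale cis_mult) (simp add: right_diff_distrib)
  also have "\<dots> = (\<Sum>n<N. \<Sum>k<N. of_real (1 / real N) *
        (x n * of_real (G k) * cis (2 * pi / real N * real k * real_of_int (int m - int n))))"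
    by (rule sum.swap)
  also have "\<dots> = (\<Sum>n<N. x n * impulse N G (int m - int n))"
    by (simp only: impulse_def sum_distrib_left mult_ac)
  finally show ?thesis .
qed

lemma received_real_decomposition:
  assumes "m < N" and gain: "\<And>k. k < N \<Longrightarrow> E k * H k = complex_of_real (G k)"
  shows "received_real md N E H b Z m =
    mean N G * sqrt 2 * bit_amplitude (b m) + ici_real md N G b m + noise_real md N E Z m"
proof -
  have "received md N E H b Z m =
      idft N (\<lambda>k. of_real (G k) * dft N (tx_symbol md b) k + E k * Z k) m"
    unfolding received_def idft_def
    by (intro arg_cong2[where f = "(*)"] sum.cong refl)
      (simp add: distrib_left gain[symmetric] mult.assoc)
  also have "\<dots> = (\<Sum>n<N. tx_symbol md b n * impulse N G (int m - int n)) + noise N E Z m"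
    using \<open>m < N\<close> by (simp only: idft_add noise_def) (simp add: idft_real_gain_dft)
  finally have "received_real md N E H b Z m =
      (\<Sum>n<N. sqrt 2 * bit_amplitude (b n) * impulse_real md N G m n) + noise_real md N E Z m"
    by (simp only: received_real_def noise_real_def derotate_add derotate_sum
        derotate_tx_symbol_mult_impulse)
  \<comment> \<open>The term \<open>n = m\<close> is the useful signal, since
    \<open>impulse_real\<close> equals \<open>mean N G\<close> on the diagonal.\<close>
  also have "(\<Sum>n<N. sqrt 2 * bit_amplitude (b n) * impulse_real md N G m n) =
      mean N G * sqrt 2 * bit_amplitude (b m) + ici_real md N G b m"
    using \<open>m < N\<close> by (subst sum.remove[of _ m]) (simp_all add: ici_real_def impulse_real_diag)
  finally show ?thesis .
qed

section \<open>Energy of the real impulse response\<close>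

text \<open>For \<open>Half_Pi_BPSK\<close>: up to multiples of \<open>2 \<pi>\<close>, the doubled rotation is \<open>\<pi> (n - m)\<close>, a frequency
  shift by \<open>N / 2\<close>.\<close>

lemma cos_double_rotation:
  assumes "0 < N" "even N"
  shows "cos (2 * pi * real_of_int (j * (int m - int n)) / real N + 2 * (rotation md n - rotation md m)) =
    cos (2 * pi * real_of_int ((j - int (reflection_center md N)) * (int m - int n)) / real N)"
proof -
  have eq: "cos x = cos y" if "x = y + 2 * pi * of_int i" for x y :: real and i :: int
    using that cos_add[of y "2 * pi * of_int i"] 
    by (simp only: cos_int_2pin sin_int_2pin mult_1_right mult_zero_right diff_zero)
  show ?thesis
  proof (cases md)
    case BPSK
    \<comment> \<open>Here the centre is \<open>N\<close>, which shifts the angle by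
      \<open>m - n\<close> whole turns.\<close>
    show ?thesis
      by (rule eq[where i = "int m - int n"]) (use assms in \<open>simp add: BPSK field_simps\<close>)
  next
    case Half_Pi_BPSK
    have half: "real (N div 2) = real N / 2"
      using assms by (simp add: real_of_nat_div)
    have parity: "real a = 2 * real (a div 2) + real (a mod 2)" for a :: nat
      by (metis mult_div_mod_eq of_nat_add of_nat_mult of_nat_numeral)
    \<comment> \<open>Splitting \<open>m\<close> and \<open>n\<close> into quotient and parity, pi
      (m - n) is pi times the difference of parities plus this number of whole turns. Evenness of
      \<open>N\<close> makes \<open>N div 2\<close> an exact half.\<close>
    show ?thesis
    proof (rule eq[where i = "int (m div 2) - int (n div 2)"])
      have "2 * pi * real_of_int ((j - int (N div 2)) * (int m - int n)) / real N =
          2 * pi * real_of_int (j * (int m - int n)) / real N - pi * (real m - real n)"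
        using assms by (simp add: half field_simps)
      also have "real m - real n =
          2 * real_of_int (int (m div 2) - int (n div 2)) + (real (m mod 2) - real (n mod 2))"
        using parity[of m] parity[of n] by simp
      finally show "2 * pi * real_of_int (j * (int m - int n)) / real N +
          2 * (rotation md n - rotation md m) =
          2 * pi * real_of_int ((j - int (reflection_center md N)) * (int m - int n)) / real N +
          2 * pi * real_of_int (int (m div 2) - int (n div 2))"
        by (simp add: Half_Pi_BPSK algebra_simps)
    qed
  qed
qed

text \<open>Residues are unique below \<open>N\<close>, so for given \<open>k\<close> the congruence
  has a single solution in range: the index that \<open>periodic\<close> reads at
  \<open>c - k\<close>.\<close>

lemma dvd_add_reflection_iff:
  fixes N k l :: nat and c :: int
  assumes "l < N"
  shows "int N dvd int k + int l - c \<longleftrightarrow> l = nat ((c - int k) mod int N)"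
proof -
  have "int N dvd int k + int l - c \<longleftrightarrow> int N dvd int l - (c - int k)"
    by (simp add: algebra_simps)
  also have "\<dots> \<longleftrightarrow> int l mod int N = (c - int k) mod int N"
    by (simp add: mod_eq_dvd_iff)
  also have "\<dots> \<longleftrightarrow> l = nat ((c - int k) mod int N)"
    using assms by auto
  finally show ?thesis .
qed

lemma ici_power_eq:
  "ici_power md N G = 1 / (2 * real N) *
    (\<Sum>k<N. G k * (periodic N G (int (reflection_center md N) - int k) + G k)) - (mean N G)\<^sup>2"
  by (cases md) simp_all

text \<open>Including \<open>n = m\<close> makes the sum run over a full period, so that
  orthogonality applies; the diagonal is removed in
  \<open>sum_impulse_real_square_off_diag\<close>.\<close>

lemma sum_impulse_real_square:
  assumes "m < N" "even N"
  shows "(\<Sum>n<N. (impulse_real md N G m n)\<^sup>2) = ici_power md N G + (mean N G)\<^sup>2"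
proof -
  define \<phi> where "\<phi> n = rotation md n - rotation md m" for n
  define C where "C j n = cos (2 * pi * real_of_int (j * (int m - int n)) / real N)" for j n
  define c where "c = int (reflection_center md N)"
  have N: "0 < N" using assms by simp
  \<comment> \<open>In the difference of the two angles the rotation cancels; in their sum it
    doubles, and \<open>cos_double_rotation\<close> absorbs it as a frequency shift by
    \<open>c\<close>.\<close>
  have prod: "cos (2 * pi / real N * real k * real_of_int (int m - int n) + \<phi> n) *
      cos (2 * pi / real N * real l * real_of_int (int m - int n) + \<phi> n) =
      (C (int k - int l) n + C (int k + int l - c) n) / 2" for k l n
  proof -
    have "C (int k + int l - c) n =
        cos (2 * pi * real_of_int ((int k + int l) * (int m - int n)) / real N + 2 * \<phi> n)"
      unfolding C_def c_def \<phi>_def by (rule cos_double_rotation[OF N \<open>even N\<close>, symmetric])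
    then show ?thesis
      unfolding cos_times_cos C_def by (simp add: algebra_simps add_divide_distrib diff_divide_distrib)
  qed
  have orth: "(\<Sum>n<N. C j n) = (if int N dvd j then real N else 0)" for j
    unfolding C_def by (rule sum_cos_orthogonal[OF N])
  have inner: "(\<Sum>l<N. G l * (\<Sum>n<N. C (int k - int l) n + C (int k + int l - c) n)) =
      real N * (periodic N G (c - int k) + G k)" if "k < N" for k
  proof -
    \<comment> \<open>Two conditionals are added because the survivors \<open>l = k\<close> and
      \<open>l = c - k\<close> modulo \<open>N\<close> may coincide, and then the term counts
      twice.\<close>
    have "(\<Sum>l<N. G l * (\<Sum>n<N. C (int k - int l) n + C (int k + int l - c) n)) =
      (\<Sum>l<N. (if l = k then real N * G l else 0) +
        (if l = nat ((c - int k) mod int N) then real N * G l else 0))"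
    proof (rule sum.cong[OF refl])
      fix l assume "l \<in> {..<N}"
      then have l: "l < N" by simp
      \<comment> \<open>The reflection lemma with index 0 and centre \<open>k\<close>.\<close>
      have "int N dvd int k - int l \<longleftrightarrow> l = k"
        using l that dvd_add_reflection_iff[of l N 0 "int k"]
        by (simp add: dvd_diff_commute)
      then show "G l * (\<Sum>n<N. C (int k - int l) n + C (int k + int l - c) n) =
        (if l = k then real N * G l else 0) +
        (if l = nat ((c - int k) mod int N) then real N * G l else 0)"
        by (simp add: sum.distrib orth dvd_add_reflection_iff[OF l])
    qed
    also have "\<dots> = real N * (periodic N G (c - int k) + G k)"
      using that N by (simp add: sum.distrib periodic_def distrib_left nat_less_iff)
    finally show ?thesis .
  qed
  have "(\<Sum>n<N. (impulse_real md N G m n)\<^sup>2) =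
      (\<Sum>n<N. \<Sum>k<N. \<Sum>l<N. 1 / (real N)\<^sup>2 * (G k * (G l *
        (cos (2 * pi / real N * real k * real_of_int (int m - int n) + \<phi> n) *
         cos (2 * pi / real N * real l * real_of_int (int m - int n) + \<phi> n)))))"
  proof -
    have "(1 / real N * (\<Sum>k<N. G k * f k))\<^sup>2 =
        (\<Sum>k<N. \<Sum>l<N. 1 / (real N)\<^sup>2 * (G k * (G l * (f k * f l))))" for f
      by (simp add: power2_eq_square sum_product sum_distrib_left sum_divide_distrib mult_ac)
    then show ?thesis
      unfolding impulse_real_cos \<phi>_def[symmetric] by simp
  qed
  also have "\<dots> = (\<Sum>n<N. \<Sum>k<N. \<Sum>l<N. 1 / (2 * (real N)\<^sup>2) * (G k * (G l *
        (C (int k - int l) n + C (int k + int l - c) n))))"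
    unfolding prod by (simp add: field_simps)
  \<comment> \<open>The sum over \<open>n\<close> moves innermost, where orthogonality acts for
    fixed \<open>k\<close> and \<open>l\<close>.\<close>
  also have "\<dots> = (\<Sum>k<N. \<Sum>l<N. \<Sum>n<N. 1 / (2 * (real N)\<^sup>2) * (G k * (G l *
        (C (int k - int l) n + C (int k + int l - c) n))))"
    by (rule trans[OF sum.swap sum.cong[OF refl sum.swap]])
  also have "\<dots> = 1 / (2 * (real N)\<^sup>2) * (\<Sum>k<N. G k * (\<Sum>l<N. G l * (\<Sum>n<N.
        C (int k - int l) n + C (int k + int l - c) n)))"
    by (simp only: sum_distrib_left)
  \<comment> \<open>Orthogonality supplies a factor \<open>N\<close>, which will reduce the
    prefactor to 1 / (2 N).\<close>
  also have "\<dots> = 1 / (2 * (real N)\<^sup>2) *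
      (\<Sum>k<N. real N * (G k * (periodic N G (c - int k) + G k)))"
    using inner by (simp add: mult.left_commute)
  also have "\<dots> = 1 / (2 * real N) * (\<Sum>k<N. G k * (periodic N G (c - int k) + G k))"
    using N by (simp add: sum_distrib_left[symmetric] power2_eq_square)
  finally show ?thesis by (simp add: ici_power_eq c_def)
qed

text \<open>The diagonal term is the squared mean gain; this is the origin of the subtracted
  \<open>(mean N G)\<^sup>2\<close>.\<close>

lemma sum_impulse_real_square_off_diag:
  assumes "m < N" "even N"
  shows "(\<Sum>n\<in>{..<N} - {m}. (impulse_real md N G m n)\<^sup>2) = ici_power md N G"
  using sum_impulse_real_square[OF assms, of md G] assms
  by (subst (asm) sum.remove[of _ m]) (simp_all add: impulse_real_diag)

section \<open>Second moments of interference and noise\<close>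

lemma sqrt_2_bit_amplitude: "sqrt 2 * bit_amplitude c = 1 - 2 * real c"
  by (simp add: bit_amplitude_def)

text \<open>Since 1 - 2 b is plus or minus 1, each summand has a deterministic square, and
  equiprobability makes its mean zero; what remains is the off-diagonal energy of the impulse
  response.\<close>

lemma (in prob_space) ici_real_second_moment:
  assumes "even N" "m < N"
    and indep: "indep_vars (\<lambda>_. count_space {0, 1}) b {..<N}"
    and equiprobable: "\<And>i. i < N \<Longrightarrow> prob {\<omega> \<in> space M. b i \<omega> = 1} = 1 / 2"
  shows "integrable M (\<lambda>\<omega>. (ici_real md N G (\<lambda>i. b i \<omega>) m)\<^sup>2)"
    and "expectation (\<lambda>\<omega>. (ici_real md N G (\<lambda>i. b i \<omega>) m)\<^sup>2) = ici_power md N G"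
proof -
  define h where "h = impulse_real md N G m"
  define X where "X n \<omega> = (1 - 2 * real (b n \<omega>)) * h n" for n \<omega>
  have ici: "ici_real md N G (\<lambda>i. b i \<omega>) m = (\<Sum>n\<in>{..<N} - {m}. X n \<omega>)" for \<omega>
    by (simp add: ici_real_def X_def h_def sqrt_2_bit_amplitude)
  have "indep_vars (\<lambda>_. borel) X {..<N}"
    unfolding X_def by (rule indep_vars_compose2[OF indep]) simp
  then have X: "indep_vars (\<lambda>_. borel) X ({..<N} - {m})"
    by (rule indep_vars_subset) auto
  have b: "b n \<in> measurable M (count_space {0, 1})" if "n < N" for n
    using indep that by (auto simp: indep_vars_def)
  \<comment> \<open>Measurability into \<open>count_space {0, 1}\<close> is what confines the bits
    to these two values.\<close>
  have bit: "b n \<omega> \<in> {0, 1}" if "n < N" "\<omega> \<in> space M" for n \<omega>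
    using measurable_space[OF b] that by simp
  have sq: "(X n \<omega>)\<^sup>2 = (h n)\<^sup>2" if "n < N" "\<omega> \<in> space M" for n \<omega>
    using bit[OF that] by (auto simp: X_def)
  have sq_int: "integrable M (\<lambda>\<omega>. (X n \<omega>)\<^sup>2)" if "n < N" for n
    using that by (subst Bochner_Integration.integrable_cong[OF refl sq]) auto
  have sq_exp: "expectation (\<lambda>\<omega>. (X n \<omega>)\<^sup>2) = (h n)\<^sup>2" if "n < N" for n
    using that by (subst Bochner_Integration.integral_cong[OF refl sq]) (auto simp: prob_space)
  have zero: "expectation (X n) = 0" if "n < N" for n
  proof -
    define A where "A = {\<omega> \<in> space M. b n \<omega> = 1}"
    have A: "A \<in> events"
      unfolding A_def using measurable_sets[OF b[OF that], of "{1}"] by (simp add: vimage_def Int_def conj_commute)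
    \<comment> \<open>On the sample space \<open>b n\<close> is the indicator of \<open>A\<close>,
      whose probability 1 / 2 makes the two contributions cancel.\<close>
    have "expectation (X n) = expectation (\<lambda>\<omega>. h n - 2 * h n * indicator A \<omega>)"
      using bit[OF that]
      by (intro Bochner_Integration.integral_cong) (force simp: X_def A_def indicator_def)+
    also have "\<dots> = h n - 2 * h n * prob A"
      using A by (subst Bochner_Integration.integral_diff) (auto simp: prob_space less_top[symmetric])
    finally show ?thesis using equiprobable[OF that] by (simp add: A_def)
  qed
  show "integrable M (\<lambda>\<omega>. (ici_real md N G (\<lambda>i. b i \<omega>) m)\<^sup>2)"
    unfolding ici by (rule second_moment_sum_indep(1)[OF _ X]) (auto simp: sq_int zero)
  have "expectation (\<lambda>\<omega>. (ici_real md N G (\<lambda>i. b i \<omega>) m)\<^sup>2) =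
      (\<Sum>n\<in>{..<N} - {m}. expectation (\<lambda>\<omega>. (X n \<omega>)\<^sup>2))"
    unfolding ici by (rule second_moment_sum_indep(2)[OF _ X]) (auto simp: sq_int zero)
  also have "\<dots> = (\<Sum>n\<in>{..<N} - {m}. (impulse_real md N G m n)\<^sup>2)"
    by (simp add: sq_exp h_def)
  also have "\<dots> = ici_power md N G"
    using assms by (simp add: sum_impulse_real_square_off_diag)
  finally show "expectation (\<lambda>\<omega>. (ici_real md N G (\<lambda>i. b i \<omega>) m)\<^sup>2) = ici_power md N G" .
qed

text \<open>Each noise sample is the real part of a weighted sum of independent circular variables.
  The weights have squared modulus |E_k|^2 / N, and the real part keeps half of the power.\<close>

lemma (in prob_space) noise_real_second_moment:
  fixes Z :: "nat \<Rightarrow> 'a \<Rightarrow> complex"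
  assumes "0 < N"
    and indep: "indep_vars (\<lambda>_. borel) Z {..<N}"
    and circ: "\<And>k. k < N \<Longrightarrow> circularly_symmetric M (Z k)"
    and zero: "\<And>k. k < N \<Longrightarrow> expectation (Z k) = 0"
    and power: "\<And>k. k < N \<Longrightarrow> expectation (\<lambda>\<omega>. (cmod (Z k \<omega>))\<^sup>2) = 1"
  shows "integrable M (\<lambda>\<omega>. (noise_real md N E (\<lambda>k. Z k \<omega>) m)\<^sup>2)"
    and "expectation (\<lambda>\<omega>. (noise_real md N E (\<lambda>k. Z k \<omega>) m)\<^sup>2) = 1 / 2 * mean N (\<lambda>k. (cmod (E k))\<^sup>2)"
proof -
  \<comment> \<open>Derotation, inverse DFT and equalizer form one weight per subcarrier; the two
    phases do not affect its modulus.\<close>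
  define w where "w k = cis (- (pi / 4 + rotation md m)) * of_real (1 / sqrt (real N)) * E k *
      cis (2 * pi / real N * real k * real m)" for k
  define X where "X k \<omega> = Re (w k * Z k \<omega>)" for k \<omega>
  have noise: "noise_real md N E (\<lambda>k. Z k \<omega>) m = (\<Sum>k<N. X k \<omega>)" for \<omega>
    unfolding noise_real_def noise_def derotate_eq idft_def X_def w_def
    by (simp only: sum_distrib_left Re_sum mult_ac)
  have rv: "random_variable borel (Z k)" if "k < N" for k
    using indep that by (auto simp: indep_vars_def)
  \<comment> \<open>A non-integrable function has integral 0 by default, which contradicts the power
    1.\<close>
  have sq: "integrable M (\<lambda>\<omega>. (cmod (Z k \<omega>))\<^sup>2)" if "k < N" for k
    by (rule ccontr) (use power[OF that] in \<open>simp add: not_integrable_integral_eq\<close>)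
  have int: "integrable M (Z k)" if "k < N" for k
  proof -
    have "integrable M (\<lambda>\<omega>. cmod (Z k \<omega>))"
      using rv[OF that] sq[OF that] by (intro square_integrable_imp_integrable[where f = "\<lambda>\<omega>. cmod (Z k \<omega>)"]) auto
    then show ?thesis using rv[OF that] by (simp add: integrable_norm_iff)
  qed
  have X: "indep_vars (\<lambda>_. borel) X {..<N}"
    unfolding X_def by (rule indep_vars_compose2[OF indep]) simp
  have X_zero: "expectation (X k) = 0" if "k < N" for k
  proof -
    have "expectation (X k) = Re (expectation (\<lambda>\<omega>. w k * Z k \<omega>))"
      unfolding X_def using int[OF that] by (intro integral_Re) simp
    then show ?thesis using zero[OF that] by simp
  qed
  have X_int: "integrable M (\<lambda>\<omega>. (X k \<omega>)\<^sup>2)" if "k < N" for k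
    unfolding X_def by (intro circularly_symmetric_Re_square(1) rv circ sq that)
  have "(cmod (w k))\<^sup>2 = (cmod (E k))\<^sup>2 / real N" for k
    by (simp add: w_def norm_mult norm_divide power_divide)
  then have X_exp: "expectation (\<lambda>\<omega>. (X k \<omega>)\<^sup>2) = 1 / 2 * (1 / real N * (cmod (E k))\<^sup>2)" if "k < N" for k
    
    unfolding X_def using that
    by (subst circularly_symmetric_Re_square(2)[OF rv circ sq]) (simp_all add: power)
  show "integrable M (\<lambda>\<omega>. (noise_real md N E (\<lambda>k. Z k \<omega>) m)\<^sup>2)"
    unfolding noise by (rule second_moment_sum_indep(1)[OF _ X]) (auto simp: X_int X_zero)
  have "expectation (\<lambda>\<omega>. (noise_real md N E (\<lambda>k. Z k \<omega>) m)\<^sup>2) =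
      (\<Sum>k<N. expectation (\<lambda>\<omega>. (X k \<omega>)\<^sup>2))"
    unfolding noise by (rule second_moment_sum_indep(2)[OF _ X]) (auto simp: X_int X_zero)
  also have "\<dots> = 1 / 2 * mean N (\<lambda>k. (cmod (E k))\<^sup>2)"
    unfolding mean_def sum_distrib_left by (rule sum.cong) (simp_all add: X_exp)
  finally show "expectation (\<lambda>\<omega>. (noise_real md N E (\<lambda>k. Z k \<omega>) m)\<^sup>2) =
      1 / 2 * mean N (\<lambda>k. (cmod (E k))\<^sup>2)" .
qed

text \<open>The first conjunct ties \<open>ici_real\<close> and \<open>noise_real\<close> to the
  actual received symbol. The integrability conjuncts ensure that the second moments are genuine and
  not the default value 0.\<close>

theorem proposition2:
  fixes M :: "'w measure"
    and md :: modulation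
    and N m :: nat
    and b :: "nat \<Rightarrow> 'w \<Rightarrow> nat"
    and Z :: "nat \<Rightarrow> 'w \<Rightarrow> complex"
    and E H :: "nat \<Rightarrow> complex"
    and G :: "nat \<Rightarrow> real"
  assumes "prob_space M"
    and "even N"
    and bits_iid: "iid_vars M (count_space {0, 1}) b {..<N}"
    and bits_equiprobable:
      "\<And>i c. i < N \<Longrightarrow> c \<in> {0, 1} \<Longrightarrow> measure M {\<omega> \<in> space M. b i \<omega> = c} = 1 / 2"
    and noise_iid: "iid_vars M borel Z {..<N}"
    and noise_gaussian: "\<And>k. k < N \<Longrightarrow> complex_gaussian M (Z k)"
    and noise_circular: "\<And>k. k < N \<Longrightarrow> circularly_symmetric M (Z k)"
    and noise_mean: "\<And>k. k < N \<Longrightarrow> (\<integral>\<omega>. Z k \<omega> \<partial>M) = 0"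
    and noise_power: "\<And>k. k < N \<Longrightarrow> (\<integral>\<omega>. (cmod (Z k \<omega>))\<^sup>2 \<partial>M) = 1"
    and noise_indep_data:
      "indep_rvs M
         (\<Pi>\<^sub>M i\<in>{..<N}. count_space {0, 1}) (\<lambda>\<omega>. \<lambda>i\<in>{..<N}. b i \<omega>)
         (\<Pi>\<^sub>M k\<in>{..<N}. borel) (\<lambda>\<omega>. \<lambda>k\<in>{..<N}. Z k \<omega>)"
    and gain_real: "\<And>k. k < N \<Longrightarrow> E k * H k = complex_of_real (G k)"
    and "m < N"
  shows "(\<forall>\<omega>\<in>space M.
            received_real md N E H (\<lambda>i. b i \<omega>) (\<lambda>k. Z k \<omega>) m =
              mean N G * sqrt 2 * bit_amplitude (b m \<omega>)
              + ici_real md N G (\<lambda>i. b i \<omega>) m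
              + noise_real md N E (\<lambda>k. Z k \<omega>) m) \<and>
         integrable M (\<lambda>\<omega>. (ici_real md N G (\<lambda>i. b i \<omega>) m)\<^sup>2) \<and>
         integrable M (\<lambda>\<omega>. (noise_real md N E (\<lambda>k. Z k \<omega>) m)\<^sup>2) \<and>
         (\<integral>\<omega>. (ici_real md N G (\<lambda>i. b i \<omega>) m)\<^sup>2 \<partial>M) = ici_power md N G \<and>
         effective_sinr M md N E G b Z m =
           (mean N G)\<^sup>2 / (ici_power md N G + 1 / 2 * mean N (\<lambda>k. (cmod (E k))\<^sup>2))"
proof -
  interpret prob_space M by fact
  have "0 < N" using \<open>m < N\<close> by simp
  have bits: "indep_vars (\<lambda>_. count_space {0, 1}) b {..<N}"
    and Z: "indep_vars (\<lambda>_. borel) Z {..<N}"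
    using bits_iid noise_iid by (auto simp: iid_vars_def)
  have one: "\<And>i. i < N \<Longrightarrow> prob {\<omega> \<in> space M. b i \<omega> = 1} = 1 / 2"
    using bits_equiprobable by simp
  note ici = ici_real_second_moment[OF \<open>even N\<close> \<open>m < N\<close> bits one]
  note noise = noise_real_second_moment[OF \<open>0 < N\<close> Z noise_circular noise_mean noise_power]
  show ?thesis
    using received_real_decomposition[OF \<open>m < N\<close> gain_real] ici noise
    by (simp add: effective_sinr_def)
qed

end
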